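(* Let $G^g,H^h$ be games with activeness such that $G^g$ is covered by $H^h$. Then $G^g=H^h$ if and only if both of the following hold: (b1) $\mathrm{type}(G^g)=\mathrm{type}(H^h)$; (b2) for every option $H'^{h'}$ of $H^h$ that is uncovered by $G^g$, there exists an option $H''^{h''}\in H'^{h'}$ with $H''^{h''}=G^g$.
   Context: Let $\mathcal{B}=\{0,1\}$. Define $\mathbb{I}_0=\{\emptyset\}\times\mathcal{B}$ and $\mathbb{I}_n=2^{\mathbb{I}_{n-1}}\times\mathcal{B}$ for $n\ge1$; a game with activeness is an element of $\mathbb{I}=\bigcup_{n\ge0}\mathbb{I}_n$. A pair $(G,g)$ is written $G^g$; the elements of $G$ are the options of $G^g$, and $g=1$ means active, $g=0$ inactive. The outcome $o$ is defined recursively: $o(G^g)=\mathscr{N}$ if $g=1$ and some option has outcome $\mathscr{P}$, and $o(G^g)=\mathscr{P}$ otherwise. The sum is $G^g+H^h=(\{G'^{g'}+H^h:G'^{g'}\in G^g\}\cup\{G^g+H'^{h'}:H'^{h'}\in H^h\})^{\max\{g,h\}}$. $G^g=H^h$ means $o(G^g+X^x)=o(H^h+X^x)$ for all games $X^x$. An option $G'^{g'}$ of $G^g$ is uncovered by $H^h$ if $G'^{g'}\neq H'^{h'}$ for all options $H'^{h'}$ of $H^h$; $G^g$ is covered by $H^h$ if $G^g$ has no option uncovered by $H^h$. $\mathrm{type}(G^g)$ is $0$ if $g=0$; $1_{\exists0}$ if $g=1$ and some option $G'^{g'}$ has $g'=0$; $1_{\forall1}$ if $g=1$ and every option $G'^{g'}$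 has $g'=1$. *)

theory Defs
  imports Main "HOL-Library.FSet"
begin

text \<open>
  The sets \<open>\<I>\<^sub>n\<close> are all finite, so a game is a hereditarily finite object: a finite set of
  games (the options) together with an activeness bit, where \<open>True\<close> stands for
  \<open>1\<close> (active) and \<open>False\<close> for \<open>0\<close> (inactive).  The theorem \<open>games_exhaust\<close>
  below relates the datatype to the layers \<open>\<I>\<^sub>n\<close>.
\<close>

datatype game = Game (opts: "game fset") (active: bool)

fun game_layer :: "nat \<Rightarrow> game set" where
  "game_layer 0 = {Game {||} b | b. True}"
| "game_layer (Suc n) = {Game S b | S b. fset S \<subseteq> game_layer n}"

lemma game_layer_Suc: "game_layer n \<subseteq> game_layer (Suc n)"
  by (induction n) force+

lemma game_layer_mono: "m \<le> n \<Longrightarrow> game_layer m \<subseteq> game_layer n"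
  using lift_Suc_mono_le[of game_layer, OF game_layer_Suc] by blast

theorem games_exhaust: "(\<Union>n. game_layer n) = UNIV"
proof -
  have "\<exists>n. G \<in> game_layer n" for G
  proof (induction G)
    case (Game S b)
    then obtain f where f: "\<And>X. X |\<in>| S \<Longrightarrow> X \<in> game_layer (f X)"
      by metis
    define n where "n = Max (insert 0 (f ` fset S))"
    have "f X \<le> n" if "X |\<in>| S" for X
      using that by (auto simp: n_def intro!: Max_ge)
    then have "fset S \<subseteq> game_layer n"
      using f game_layer_mono by blast
    then have "Game S b \<in> game_layer (Suc n)"
      by auto
    then show ?case ..
  qed
  then show ?thesis by auto
qed

lemma size_option: "X |\<in>| S \<Longrightarrow> size X < size (Game S b)"
  by (induction S) (auto simp: less_Suc_eq_le size_fset_overloaded_simps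
      intro!: member_le_sum le_SucI)

datatype outcome_class = \<N> | \<P>

function outcome :: "game \<Rightarrow> outcome_class" where
  "outcome (Game S g) = (if g \<and> (\<exists>G'\<in>fset S. outcome G' = \<P>) then \<N> else \<P>)"
  by pat_completeness auto
termination
  by (relation "measure size") (auto simp del: game.size dest: size_option)

function game_plus :: "game \<Rightarrow> game \<Rightarrow> game" (infixl "\<oplus>" 65) where
  "Game S g \<oplus> Game T h =
     Game ((\<lambda>G'. G' \<oplus> Game T h) |`| S |\<union>| (\<lambda>H'. Game S g \<oplus> H') |`| T) (max g h)"
  by pat_completeness auto
termination
  by (relation "measure (\<lambda>(G, H). size G + size H)")
     (auto simp del: game.size dest: size_option)

definition game_eq :: "game \<Rightarrow> game \<Rightarrow> bool" (infix "\<doteq>" 50) where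
  "G \<doteq> H \<longleftrightarrow> (\<forall>X. outcome (G \<oplus> X) = outcome (H \<oplus> X))"

definition is_option :: "game \<Rightarrow> game \<Rightarrow> bool" where
  "is_option G' G \<longleftrightarrow> G' |\<in>| opts G"

definition uncovered :: "game \<Rightarrow> game \<Rightarrow> game \<Rightarrow> bool" where
  "uncovered G' G H \<longleftrightarrow>
     is_option G' G \<and> (\<forall>H'. is_option H' H \<longrightarrow> \<not> G' \<doteq> H')"

definition covered_by :: "game \<Rightarrow> game \<Rightarrow> bool" where
  "covered_by G H \<longleftrightarrow> \<not> (\<exists>G'. uncovered G' G H)"

datatype game_type = Type0 | Type1_ex0 | Type1_all1

definition type_of :: "game \<Rightarrow> game_type" where
  "type_of G =
     (if \<not> active G then Type0
      else if \<exists>G'. is_option G' G \<and> \<not> active G' then Type1_ex0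
      else Type1_all1)"

end

theory Submission
  imports Defs
begin

text \<open>
  Every game has a mate: an active game whose sum with it is a \<open>\<P>\<close>-position. Adding mates of
  the options of \<open>G\<close> to an active test game makes every move from \<open>G\<close> a losing one, which allows
  one to separate two different games in a prescribed direction by an active game, and to separate
  games of different types. If \<open>H'\<close> violates (b2), the games separating \<open>H'\<close> from the options of
  \<open>G\<close> and \<open>G\<close> from the options of \<open>H'\<close> are the options of an active game \<open>X\<close> such that both
  \<open>G \<oplus> X\<close> and \<open>H' \<oplus> X\<close> are \<open>\<P>\<close>-positions; then \<open>X\<close> distinguishes \<open>G\<close> from \<open>H\<close>.
  Conversely, (b2) says that moves of \<open>H\<close> not available in \<open>G\<close> are reversible, and (b1) deals with
  the positions in which the reversing move cannot be played because play has already stopped.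
\<close>

lemma outcome_neq_N_iff: "outcome G \<noteq> \<N> \<longleftrightarrow> outcome G = \<P>"
  by (cases "outcome G") auto

lemma outcome_eqI: "(outcome G = \<N> \<longleftrightarrow> outcome H = \<N>) \<Longrightarrow> outcome G = outcome H"
  by (cases "outcome G"; cases "outcome H") auto

lemma outcome_plus_eq_N_iff:
  "outcome (G \<oplus> X) = \<N> \<longleftrightarrow> (active G \<or> active X) \<and>
     ((\<exists>G'. is_option G' G \<and> outcome (G' \<oplus> X) = \<P>) \<or>
      (\<exists>X'. is_option X' X \<and> outcome (G \<oplus> X') = \<P>))"
  by (cases G; cases X) (auto simp: is_option_def max_def)

lemma outcome_plus_eq_P_iff:
  "outcome (G \<oplus> X) = \<P> \<longleftrightarrow> (active G \<or> active X \<longrightarrow>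
     (\<forall>G'. is_option G' G \<longrightarrow> outcome (G' \<oplus> X) = \<N>) \<and>
     (\<forall>X'. is_option X' X \<longrightarrow> outcome (G \<oplus> X') = \<N>))"
  using outcome_plus_eq_N_iff[of G X] by (simp flip: outcome_neq_N_iff) blast

lemma outcome_plus_eq_N_left:
  assumes "active G \<or> active X" "is_option G' G" "outcome (G' \<oplus> X) = \<P>"
  shows "outcome (G \<oplus> X) = \<N>"
  using assms by (subst outcome_plus_eq_N_iff) blast

lemma outcome_plus_eq_N_right:
  assumes "active G \<or> active X" "is_option X' X" "outcome (G \<oplus> X') = \<P>"
  shows "outcome (G \<oplus> X) = \<N>"
  using assms by (subst outcome_plus_eq_N_iff) blast

lemma is_option_Game [simp]: "is_option X (Game S b) \<longleftrightarrow> X |\<in>| S"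
  by (simp add: is_option_def)

lemma game_option_induct [case_names options]:
  assumes "\<And>G. (\<And>G'. is_option G' G \<Longrightarrow> P G') \<Longrightarrow> P G"
  shows "P G"
proof (induction G)
  case (Game S b)
  show ?case by (rule assms) (simp add: Game)
qed

lemma game_eq_commute: "G \<doteq> H \<longleftrightarrow> H \<doteq> G"
  by (auto simp: game_eq_def)

text \<open>The options of \<open>M\<close> are mates of the options of \<open>G\<close>, so a move
  to \<open>G'\<close> is answered by \<open>m G'\<close> and a move to \<open>m G'\<close> by
  \<open>G'\<close>. Activeness belongs to the induction claim: it keeps the answer
  \<open>G'\<close> legal in \<open>G \<oplus> m G'\<close> even when \<open>G\<close> is
  inactive.\<close>

lemma ex_mate: "\<exists>M. active M \<and> outcome (G \<oplus> M) = \<P>"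
proof (induction G rule: game_option_induct)
  case (options G)
  then obtain m where
    m: "\<And>G'. is_option G' G \<Longrightarrow> active (m G') \<and> outcome (G' \<oplus> m G') = \<P>"
    by metis
  define M where "M = Game (m |`| opts G) True"
  have opt_M: "is_option X M \<longleftrightarrow> (\<exists>G'. is_option G' G \<and> X = m G')" for X
    by (auto simp: M_def is_option_def)
  have act: "active M" by (simp add: M_def)
  have "outcome (G' \<oplus> M) = \<N>" if "is_option G' G" for G'
    using that m act opt_M by (intro outcome_plus_eq_N_right[of G' M "m G'"]) auto
  moreover have "outcome (G \<oplus> X) = \<N>" if "is_option X M" for X
    using that m by (auto simp: opt_M intro: outcome_plus_eq_N_left)
  ultimately show ?case
    using act outcome_plus_eq_P_iff[of G M] by blast
qed

lemma obtain_mates: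
  obtains m where "\<And>G. active (m G)" "\<And>G. outcome (G \<oplus> m G) = \<P>"
  using ex_mate by metis

text \<open>Offer \<open>T\<close> as an option of \<open>U\<close>: moving to it wins from
  \<open>H \<oplus> U\<close> but loses from \<open>G \<oplus> U\<close>. The mates of the options
  of \<open>G\<close>, added to \<open>U\<close>, refute every other move from
  \<open>G \<oplus> U\<close>.\<close>

lemma switch_separation:
  assumes "outcome (G \<oplus> T) = \<N>" "outcome (H \<oplus> T) = \<P>"
  shows "\<exists>U. active U \<and> outcome (G \<oplus> U) = \<P> \<and> outcome (H \<oplus> U) = \<N>"
proof -
  obtain m where m: "\<And>G. active (m G)" "\<And>G. outcome (G \<oplus> m G) = \<P>"
    using obtain_mates by blast
  define U where "U = Game (finsert T (m |`| opts G)) True"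
  have opt_U: "is_option X U \<longleftrightarrow> X = T \<or> (\<exists>G'. is_option G' G \<and> X = m G')" for X
    by (auto simp: U_def is_option_def)
  have act: "active U" by (simp add: U_def)
  have "outcome (G' \<oplus> U) = \<N>" if "is_option G' G" for G'
    using that m act opt_U by (intro outcome_plus_eq_N_right[of G' U "m G'"]) auto
  moreover have "outcome (G \<oplus> X) = \<N>" if "is_option X U" for X
    using that m assms(1) by (auto simp: opt_U intro: outcome_plus_eq_N_left)
  ultimately have "outcome (G \<oplus> U) = \<P>"
    using outcome_plus_eq_P_iff[of G U] by blast
  moreover have "outcome (H \<oplus> U) = \<N>"
    using act opt_U assms(2) by (intro outcome_plus_eq_N_right[of H U T]) auto
  ultimately show ?thesis using act by blast
qed

lemma not_game_eq_separation:
  assumes "\<not> G \<doteq> H"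
  shows "\<exists>U. active U \<and> outcome (G \<oplus> U) = \<P> \<and> outcome (H \<oplus> U) = \<N>"
proof -
  obtain T where "outcome (G \<oplus> T) \<noteq> outcome (H \<oplus> T)"
    using assms by (auto simp: game_eq_def)
  then consider "outcome (G \<oplus> T) = \<N>" "outcome (H \<oplus> T) = \<P>"
    | "outcome (H \<oplus> T) = \<N>" "outcome (G \<oplus> T) = \<P>"
    using outcome_neq_N_iff by metis
  then show ?thesis
  proof cases
    case 1
    then show ?thesis by (rule switch_separation)
  next
    case 2
    \<comment> \<open>The outcomes already have the wanted direction, but \<open>T\<close> may be
      inactive; switching twice restores the direction with an active test game.\<close>
    then obtain U where "outcome (H \<oplus> U) = \<P>" "outcome (G \<oplus> U) = \<N>"
      using switch_separation by blast
    then show ?thesis using switch_separation by blast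
  qed
qed

lemma not_game_eq_if_inactive_active:
  assumes "\<not> active G" "active H"
  shows "\<not> G \<doteq> H"
proof -
  obtain m where m: "\<And>G. active (m G)" "\<And>G. outcome (G \<oplus> m G) = \<P>"
    using obtain_mates by blast
  \<comment> \<open>With \<open>X\<close> inactive, play in \<open>G \<oplus> X\<close> has already
    stopped, whereas \<open>H \<oplus> X\<close> still allows the winning move to
    \<open>H \<oplus> m H\<close>.\<close>
  define X where "X = Game {|m H|} False"
  have "outcome (G \<oplus> X) = \<P>"
    using assms(1) outcome_plus_eq_P_iff[of G X] by (simp add: X_def)
  moreover have "outcome (H \<oplus> X) = \<N>"
    using assms(2) m by (intro outcome_plus_eq_N_right[of H X "m H"]) (auto simp: X_def)
  ultimately show ?thesis
    by (metis game_eq_def outcome_class.distinct(1))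
qed

lemma not_game_eq_if_ex0_all1:
  assumes "type_of G = Type1_ex0" "type_of H = Type1_all1"
  shows "\<not> G \<doteq> H"
proof -
  obtain m where m: "\<And>G. active (m G)" "\<And>G. outcome (G \<oplus> m G) = \<P>"
    using obtain_mates by blast
  obtain G' where G: "active G" "is_option G' G" "\<not> active G'"
    using assms(1) by (auto simp: type_of_def split: if_splits)
  have H: "active H" "\<And>H'. is_option H' H \<Longrightarrow> active H'"
    using assms(2) by (auto simp: type_of_def split: if_splits)
  \<comment> \<open>Moving to the inactive \<open>G'\<close> ends play at once and wins from
    \<open>G \<oplus> X\<close>. From \<open>H \<oplus> X\<close>, a move to \<open>H'\<close>
    leaves an active component, so the answer \<open>m H'\<close> is legal; a move to
    \<open>m H'\<close> is answered by \<open>H'\<close>.\<close>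
  define X where "X = Game (m |`| opts H) False"
  have opt_X: "is_option Y X \<longleftrightarrow> (\<exists>H'. is_option H' H \<and> Y = m H')" for Y
    by (auto simp: X_def is_option_def)
  have "outcome (G' \<oplus> X) = \<P>"
    using G(3) outcome_plus_eq_P_iff[of G' X] by (simp add: X_def)
  then have "outcome (G \<oplus> X) = \<N>"
    using G outcome_plus_eq_N_left by blast
  moreover have "outcome (H' \<oplus> X) = \<N>" if "is_option H' H" for H'
    using that m H opt_X by (intro outcome_plus_eq_N_right[of H' X "m H'"]) auto
  moreover have "outcome (H \<oplus> Y) = \<N>" if "is_option Y X" for Y
    using that m by (auto simp: opt_X intro: outcome_plus_eq_N_left)
  ultimately show ?thesis
    by (metis game_eq_def outcome_class.distinct(1) outcome_plus_eq_P_iff[of H X])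
qed

lemma game_eq_imp_type_of_eq:
  assumes "G \<doteq> H"
  shows "type_of G = type_of H"
proof -
  have sym: "H \<doteq> G"
    using assms by (simp add: game_eq_commute)
  have "active G \<longleftrightarrow> active H"
    using assms sym not_game_eq_if_inactive_active by blast
  moreover have "type_of G = Type0 \<longleftrightarrow> \<not> active G" "type_of H = Type0 \<longleftrightarrow> \<not> active H"
    by (simp_all add: type_of_def)
  ultimately show ?thesis
    using assms sym not_game_eq_if_ex0_all1[of G H] not_game_eq_if_ex0_all1[of H G]
    by (cases "type_of G"; cases "type_of H") auto
qed

text \<open>The option \<open>sep G' H\<close> of \<open>X\<close> has two uses: it answers a move
  to \<open>G'\<close>, and, when chosen first, it loses in both sums: in
  \<open>G \<oplus> X\<close> to the answer \<open>G'\<close>, in \<open>H \<oplus> X\<close> by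
  separation. The options \<open>sep H' G\<close> act symmetrically.\<close>

lemma ex_common_P_summand:
  assumes "\<And>G'. is_option G' G \<Longrightarrow> \<not> G' \<doteq> H" and "\<And>H'. is_option H' H \<Longrightarrow> \<not> H' \<doteq> G"
  shows "\<exists>X. active X \<and> outcome (G \<oplus> X) = \<P> \<and> outcome (H \<oplus> X) = \<P>"
proof -
  obtain sep where sep: "\<And>A B. \<not> A \<doteq> B \<Longrightarrow>
      active (sep A B) \<and> outcome (A \<oplus> sep A B) = \<P> \<and> outcome (B \<oplus> sep A B) = \<N>"
    using not_game_eq_separation by metis
  define X where
    "X = Game ((\<lambda>G'. sep G' H) |`| opts G |\<union>| (\<lambda>H'. sep H' G) |`| opts H) True"
  have opt_X: "is_option Y X \<longleftrightarrow> (\<exists>G'. is_option G' G \<and> Y = sep G' H)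
      \<or> (\<exists>H'. is_option H' H \<and> Y = sep H' G)" for Y
    by (auto simp: X_def is_option_def)
  have act: "active X" by (simp add: X_def)
  have G': "active (sep G' H)" "outcome (G' \<oplus> sep G' H) = \<P>" "outcome (H \<oplus> sep G' H) = \<N>"
    if "is_option G' G" for G'
    using sep assms(1) that by blast+
  have H': "active (sep H' G)" "outcome (H' \<oplus> sep H' G) = \<P>" "outcome (G \<oplus> sep H' G) = \<N>"
    if "is_option H' H" for H'
    using sep assms(2) that by blast+
  have "outcome (G' \<oplus> X) = \<N>" if "is_option G' G" for G'
    using that G' act opt_X by (intro outcome_plus_eq_N_right[of G' X "sep G' H"]) auto
  moreover have "outcome (H' \<oplus> X) = \<N>" if "is_option H' H" for H'
    using that H' act opt_X by (intro outcome_plus_eq_N_right[of H' X "sep H' G"]) auto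
  moreover have "outcome (G \<oplus> Y) = \<N> \<and> outcome (H \<oplus> Y) = \<N>" if "is_option Y X" for Y
    using that G' H' by (auto simp: opt_X intro: outcome_plus_eq_N_left)
  ultimately show ?thesis
    using act outcome_plus_eq_P_iff[of G X] outcome_plus_eq_P_iff[of H X] by blast
qed

lemma game_eq_imp_reversible:
  assumes "G \<doteq> H" "uncovered H' H G"
  shows "\<exists>H''. is_option H'' H' \<and> H'' \<doteq> G"
proof (rule ccontr)
  assume "\<not> ?thesis"
  moreover have "is_option H' H" and "\<And>G'. is_option G' G \<Longrightarrow> \<not> G' \<doteq> H'"
    using assms(2) by (auto simp: uncovered_def game_eq_commute[of H'])
  ultimately obtain X where "active X" "outcome (G \<oplus> X) = \<P>" "outcome (H' \<oplus> X) = \<P>"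
    using ex_common_P_summand[of G H'] by blast
  moreover from this have "outcome (H \<oplus> X) = \<N>"
    using \<open>is_option H' H\<close> by (intro outcome_plus_eq_N_left[of H X H']) auto
  ultimately show False
    using assms(1) by (simp add: game_eq_def)
qed

text \<open>Induction on the test game \<open>X\<close> alone suffices: moves in \<open>X\<close>
  fall to the induction hypothesis, while moves in \<open>G\<close> or \<open>H\<close> are matched
  by equal options or reversed with \<open>X\<close> unchanged.\<close>

lemma game_eq_if_reversible:
  assumes cov: "covered_by G H"
    and type: "type_of G = type_of H"
    and rev: "\<And>H'. uncovered H' H G \<Longrightarrow> \<exists>H''. is_option H'' H' \<and> H'' \<doteq> G"
  shows "G \<doteq> H"
proof -
  have act: "active G \<longleftrightarrow> active H"
    using type by (auto simp: type_of_def split: if_splits)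
  have "outcome (G \<oplus> X) = outcome (H \<oplus> X)" for X
  proof (induction X rule: game_option_induct)
    case X: (options X)
    show ?case
    proof (rule outcome_eqI, rule iffI)
      assume N: "outcome (G \<oplus> X) = \<N>"
      then have "active H \<or> active X"
        using act outcome_plus_eq_N_iff[of G X] by blast
      moreover have "\<exists>H'. is_option H' H \<and> outcome (H' \<oplus> X) = \<P>"
        if G': "is_option G' G" "outcome (G' \<oplus> X) = \<P>" for G'
      proof -
        obtain H' where "is_option H' H" "G' \<doteq> H'"
          using cov G'(1) unfolding covered_by_def uncovered_def by blast
        then show ?thesis using G'(2) by (auto simp: game_eq_def)
      qed
      ultimately show "outcome (H \<oplus> X) = \<N>"
        using N X outcome_plus_eq_N_iff[of G X] outcome_plus_eq_N_iff[of H X] by auto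
    next
      assume N: "outcome (H \<oplus> X) = \<N>"
      then have actX: "active G \<or> active X"
        using act outcome_plus_eq_N_iff[of H X] by blast
      from N consider
          X' where "is_option X' X" "outcome (H \<oplus> X') = \<P>"
        | H' where "is_option H' H" "outcome (H' \<oplus> X) = \<P>"
        using outcome_plus_eq_N_iff[of H X] by blast
      then show "outcome (G \<oplus> X) = \<N>"
      proof cases
        case (1 X')
        then show ?thesis using X[of X'] actX by (intro outcome_plus_eq_N_right[of G X X']) auto
      next
        case H': (2 H')
        show ?thesis
        proof (cases "uncovered H' H G")
          case False
          then obtain G' where "is_option G' G" "H' \<doteq> G'"
            using H'(1) unfolding uncovered_def by blast
          then show ?thesis
            using H'(2) actX by (intro outcome_plus_eq_N_left[of G X G']) (auto simp: game_eq_def)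
        next
          case True
          then obtain H'' where H'': "is_option H'' H'" "H'' \<doteq> G"
            using rev by blast
          show ?thesis
          proof (cases "active H' \<or> active X")
            case True
            \<comment> \<open>Play continues in the \<P>-position \<open>H' \<oplus> X\<close>, so
              each of its options is an \<N>-position; the reversing one has the same outcome as
              \<open>G \<oplus> X\<close>.\<close>
            then have "outcome (H'' \<oplus> X) = \<N>"
              using H'(2) H''(1) outcome_plus_eq_P_iff[of H' X] by blast
            then show ?thesis using H''(2) by (simp add: game_eq_def)
          next
            case False
            \<comment> \<open>Here \<open>H'\<close> and \<open>X\<close> are inactive, so no
              reversing move is available. As \<open>X\<close> is inactive, \<open>G\<close> and
              hence \<open>H\<close> must be active, and \<open>H'\<close> is an inactive option of
              \<open>H\<close>; equality of types gives \<open>G\<close> an inactive option too,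
              whose sum with \<open>X\<close> is over.\<close>
            then have "type_of G = Type1_ex0"
              using type act actX H'(1) by (auto simp: type_of_def)
            then obtain G' where G': "is_option G' G" "\<not> active G'"
              by (auto simp: type_of_def split: if_splits)
            then have "outcome (G' \<oplus> X) = \<P>"
              using False outcome_plus_eq_P_iff[of G' X] by blast
            then show ?thesis using G'(1) actX by (intro outcome_plus_eq_N_left)
          qed
        qed
      qed
    qed
  qed
  then show ?thesis
    by (simp add: game_eq_def)
qed

theorem theorem3p34:
  fixes G H :: game
  assumes "covered_by G H"
  shows "G \<doteq> H \<longleftrightarrow>
    type_of G = type_of H \<and>
    (\<forall>H'. uncovered H' H G \<longrightarrow> (\<exists>H''. is_option H'' H' \<and> H'' \<doteq> G))"
proof (intro iffI conjI allI impI)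
  assume "G \<doteq> H"
  then show "type_of G = type_of H"
    by (rule game_eq_imp_type_of_eq)
  show "\<exists>H''. is_option H'' H' \<and> H'' \<doteq> G" if "uncovered H' H G" for H'
    using \<open>G \<doteq> H\<close> that by (rule game_eq_imp_reversible)
next
  assume "type_of G = type_of H \<and>
    (\<forall>H'. uncovered H' H G \<longrightarrow> (\<exists>H''. is_option H'' H' \<and> H'' \<doteq> G))"
  then show "G \<doteq> H"
    using game_eq_if_reversible[OF assms] by simp
qed

end
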